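(* For a complete bipartite graph $K_{a,b}$ with $a\ge b$ and $a+b=n$, $$\mathcal{S}_{\chi^-}(K_{a,b},x)=(2a+4b)+3ab\,x+\bigl(a(a-1)+2b(b-1)\bigr)x^2$$ and $$\mathcal{S}_{\chi^+}(K_{a,b},x)=(4a+2b)+3ab\,x+\bigl(2a(a-1)+b(b-1)\bigr)x^2.$$
   Context: All graphs are finite, simple, undirected and connected ($K_{a,b}$ has parts of sizes $a,b\ge 1$); $d(u,v)$ is the usual graph distance. Let $\ell=\chi(G)$ be the chromatic number of $G$. All colourings considered are proper vertex colourings with exactly $\ell$ colours $c_1,\dots,c_\ell$; for such a colouring $\varphi$ put $\zeta_\varphi(v)=s$ if $\varphi(v)=c_s$. A $\chi^-$-colouring of $G$ is such a colouring in which $c_1$ is assigned to the maximum possible number of vertices, then, subject to this, $c_2$ is assigned to the maximum possible number of the remaining vertices, and so on until all vertices are coloured. A $\chi^+$-colouring is defined in the same way with the colours taken in the order $c_\ell,c_{\ell-1},\dots,c_1$. With $\varphi^-$ a $\chi^-$-colouring and $\varphi^+$ a $\chi^+$-colouring of $G$, the $\chi^-$- and $\chi^+$-chromatic Schultz polynomials of $G$ are $$\mathcal{S}_{\chi^\mp}(G,x)=\sum_{u,v\in V(G)}\bigl(\zeta_{\varphi^\mp}(u)+\zeta_{\varphi^\mp}(v)\bigr)x^{d(u,v)},$$ where the sum runs over unordered pairs $\{u,v\}$ of vertices, each counted once, with the case $u=v$ included (so each vertex $v$ contributes $2\zeta(v)$ to the constant term). *)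

theory Defs
  imports
    "Graph_Theory.Kuratowski"
    "Graph_Theory.Shortest_Path"
    "HOL-Computational_Algebra.Polynomial"
begin

text \<open>
  Finite simple graphs are represented as in the \<^theory>\<open>Graph_Theory.Digraph\<close> development:
  the locale predicate \<^const>\<open>graph\<close> describes finite symmetric digraphs without loops and
  parallel arcs, each undirected edge being a pair of opposite arcs.
\<close>

text \<open>
  The usual distance, as a natural number; only meaningful if \<open>v\<close> is reachable from \<open>u\<close>.
  Lemma \<open>gdist_eq_mu\<close> below relates it to the library's shortest-path weight.
\<close>
definition gdist :: "('a, 'b) pre_digraph \<Rightarrow> 'a \<Rightarrow> 'a \<Rightarrow> nat" where
  "gdist G u v = (LEAST k. \<exists>p. pre_digraph.awalk G u p v \<and> length p = k)"

definition proper_colouring :: "('a, 'b) pre_digraph \<Rightarrow> ('a \<Rightarrow> nat) \<Rightarrow> bool" where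
  "proper_colouring G \<phi> \<longleftrightarrow> (\<forall>(u, v) \<in> arcs_ends G. \<phi> u \<noteq> \<phi> v)"

text \<open>
  The colour \<open>c\<^sub>s\<close> is represented by its index \<open>s \<ge> 1\<close>, so that a colouring \<open>\<phi>\<close> coincides
  with its index function \<open>\<zeta>\<^sub>\<phi>\<close>.
\<close>
definition chromatic_number :: "('a, 'b) pre_digraph \<Rightarrow> nat" where
  "chromatic_number G = (LEAST k. \<exists>\<phi>. proper_colouring G \<phi> \<and> \<phi> ` verts G \<subseteq> {1..k})"

definition chi_colourings :: "('a, 'b) pre_digraph \<Rightarrow> ('a \<Rightarrow> nat) set" where
  "chi_colourings G =
     {\<phi>. proper_colouring G \<phi> \<and> \<phi> ` verts G = {1..chromatic_number G}}"

definition colour_weight :: "('a, 'b) pre_digraph \<Rightarrow> ('a \<Rightarrow> nat) \<Rightarrow> nat \<Rightarrow> nat" where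
  "colour_weight G \<phi> s = card {v \<in> verts G. \<phi> v = s}"

text \<open>
  \<open>greedy_max G ss C\<close> selects from \<open>C\<close> the colourings that use the first colour of \<open>ss\<close> as
  often as possible, from these the ones that use the second colour as often as possible,
  and so on.
\<close>
fun greedy_max ::
  "('a, 'b) pre_digraph \<Rightarrow> nat list \<Rightarrow> ('a \<Rightarrow> nat) set \<Rightarrow> ('a \<Rightarrow> nat) set" where
  "greedy_max G [] C = C"
| "greedy_max G (s # ss) C =
     greedy_max G ss {\<phi> \<in> C. \<forall>\<psi> \<in> C. colour_weight G \<psi> s \<le> colour_weight G \<phi> s}"

definition chi_minus_colouring :: "('a, 'b) pre_digraph \<Rightarrow> ('a \<Rightarrow> nat) \<Rightarrow> bool" where
  "chi_minus_colouring G \<phi> \<longleftrightarrow>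
     \<phi> \<in> greedy_max G [1..<Suc (chromatic_number G)] (chi_colourings G)"

definition chi_plus_colouring :: "('a, 'b) pre_digraph \<Rightarrow> ('a \<Rightarrow> nat) \<Rightarrow> bool" where
  "chi_plus_colouring G \<phi> \<longleftrightarrow>
     \<phi> \<in> greedy_max G (rev [1..<Suc (chromatic_number G)]) (chi_colourings G)"

text \<open>
  The sum runs over the unordered pairs \<open>{u, v}\<close>, singletons (\<open>u = v\<close>) included. The summand
  is evaluated at an arbitrary ordering of the pair; by lemma \<open>schultz_term_pair\<close> below the
  choice is irrelevant.
\<close>
definition schultz_term :: "('a, 'b) pre_digraph \<Rightarrow> ('a \<Rightarrow> nat) \<Rightarrow> 'a set \<Rightarrow> int poly" where
  "schultz_term G \<zeta> P =
     (let (u, v) = (SOME (u, v). P = {u, v}) in monom (int (\<zeta> u) + int (\<zeta> v)) (gdist G u v))"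

definition schultz_poly :: "('a, 'b) pre_digraph \<Rightarrow> ('a \<Rightarrow> nat) \<Rightarrow> int poly" where
  "schultz_poly G \<zeta> =
     (\<Sum>P \<in> {{u, v} | u v. u \<in> verts G \<and> v \<in> verts G}. schultz_term G \<zeta> P)"


lemma (in sym_digraph) awalk_reverse:
  assumes "awalk u p v"
  shows "\<exists>q. awalk v q u \<and> length q = length p"
  using assms
proof (induction p arbitrary: u)
  case Nil
  then show ?case by (auto simp: awalk_Nil_iff)
next
  case (Cons e p)
  then have e: "e \<in> arcs G" "tail G e = u" and p: "awalk (head G e) p v"
    by (auto simp: awalk_Cons_iff)
  obtain q where q: "awalk v q (head G e)" "length q = length p"
    using Cons.IH[OF p] by blast
  have "(head G e, tail G e) \<in> arcs_ends G"
    using e sym_arcs by (auto simp: symmetric_def arcs_ends_conv elim: symE)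
  then obtain f where f: "f \<in> arcs G" "tail G f = head G e" "head G f = u"
    using e by (auto simp: arcs_ends_conv)
  then have "awalk (head G e) [f] u"
    by (auto simp: awalk_Cons_iff awalk_Nil_iff)
  with q have "awalk v (q @ [f]) u" "length (q @ [f]) = length (e # p)"
    by auto
  then show ?case by blast
qed

lemma (in sym_digraph) gdist_commute: "gdist G u v = gdist G v u"
proof -
  have "(\<exists>p. awalk u p v \<and> length p = k) \<longleftrightarrow> (\<exists>p. awalk v p u \<and> length p = k)" for k
    using awalk_reverse by metis
  then show ?thesis by (simp add: gdist_def)
qed

lemma (in wf_digraph) gdist_eq_mu:
  assumes "u \<rightarrow>\<^sup>* v"
  shows "\<mu> (\<lambda>_. 1) u v = ereal (real (gdist G u v))"
proof -
  have cost: "awalk_cost (\<lambda>_. 1) p = real (length p)" for p :: "'b list"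
    by (induction p) auto
  have ex: "\<exists>k p. awalk u p v \<and> length p = k"
    using assms by (auto simp: reachable_awalk)
  obtain p where p: "awalk u p v" "length p = gdist G u v"
    using LeastI_ex[OF ex] unfolding gdist_def by blast
  have "gdist G u v \<le> length q" if "awalk u q v" for q
    unfolding gdist_def using that by (intro Least_le) blast
  then show ?thesis
    unfolding \<mu>_def cost using p
    by (intro antisym INF_greatest) (auto intro!: INF_lower2[of p])
qed

lemma (in sym_digraph) schultz_term_pair:
  "schultz_term G \<zeta> {u, v} = monom (int (\<zeta> u) + int (\<zeta> v)) (gdist G u v)"
proof -
  obtain x y where xy: "(SOME (x, y). {u, v} = {x, y}) = (x, y)"
    by (rule prod.exhaust)
  have "case (SOME (x, y). {u, v} = {x, y}) of (x, y) \<Rightarrow> {u, v} = {x, y}"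
    by (rule someI[where x = "(u, v)"]) simp
  then have "{u, v} = {x, y}" by (simp add: xy)
  then have "x = u \<and> y = v \<or> x = v \<and> y = u" by (auto simp: doubleton_eq_iff)
  then show ?thesis
    using gdist_commute[of u v] by (auto simp: schultz_term_def xy add.commute)
qed

lemma greedy_max_nonempty:
  assumes "finite (verts G)" "C \<noteq> {}"
  shows "greedy_max G ss C \<noteq> {}"
  using assms(2)
proof (induction ss arbitrary: C)
  case (Cons s ss)
  let ?W = "(\<lambda>\<phi>. colour_weight G \<phi> s) ` C"
  have "?W \<subseteq> {..card (verts G)}"
    using assms(1) by (auto simp: colour_weight_def intro: card_mono)
  then have fin: "finite ?W" using finite_subset by blast
  then have "Max ?W \<in> ?W" using Cons.prems by (intro Max_in) auto
  then obtain \<phi> where "\<phi> \<in> C" "colour_weight G \<phi> s = Max ?W" by auto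
  then have "\<phi> \<in> {\<phi> \<in> C. \<forall>\<psi> \<in> C. colour_weight G \<psi> s \<le> colour_weight G \<phi> s}"
    using fin by auto
  then show ?case unfolding greedy_max.simps by (intro Cons.IH) blast
qed simp

lemma (in graph) chi_colourings_nonempty: "chi_colourings G \<noteq> {}"
proof -
  let ?col = "\<lambda>k. \<exists>\<phi>. proper_colouring G \<phi> \<and> \<phi> ` verts G \<subseteq> {1..k}"
  have verts: "u \<in> verts G \<and> v \<in> verts G \<and> u \<noteq> v" if "(u, v) \<in> arcs_ends G" for u v
    using that no_loops by (auto simp: arcs_ends_conv)
  obtain f where f: "bij_betw f (verts G) {0..<card (verts G)}"
    using ex_bij_betw_finite_nat[OF finite_verts] by blast
  have "proper_colouring G (\<lambda>v. Suc (f v))"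
    using verts bij_betw_imp_inj_on[OF f] by (fastforce simp: proper_colouring_def inj_on_def)
  moreover have "(\<lambda>v. Suc (f v)) ` verts G \<subseteq> {1..card (verts G)}"
    using bij_betw_apply[OF f] by (auto simp: Suc_le_eq)
  ultimately have ex: "\<exists>k. ?col k" by blast
  define l where "l = chromatic_number G"
  obtain \<phi> where \<phi>: "proper_colouring G \<phi>" "\<phi> ` verts G \<subseteq> {1..l}"
    using LeastI_ex[OF ex] unfolding l_def chromatic_number_def by blast
  have "s \<in> \<phi> ` verts G" if s: "s \<in> {1..l}" for s
  proof (rule ccontr)
    assume unused: "s \<notin> \<phi> ` verts G"
    define \<psi> where "\<psi> v = (if \<phi> v > s then \<phi> v - 1 else \<phi> v)" for v
    have less_or_greater: "\<phi> v < s \<or> s < \<phi> v" if "v \<in> verts G" for v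
      using unused that by (metis imageI linorder_neqE_nat)
    have "proper_colouring G \<psi>"
      unfolding proper_colouring_def
    proof clarify
      fix u v assume a: "(u, v) \<in> arcs_ends G" and eq: "\<psi> u = \<psi> v"
      have "\<phi> u \<noteq> \<phi> v" using \<phi>(1) a by (auto simp: proper_colouring_def)
      with eq less_or_greater[of u] less_or_greater[of v] verts[OF a] show False
        by (auto simp: \<psi>_def split: if_splits)
    qed
    moreover have "\<psi> ` verts G \<subseteq> {1..l - 1}"
    proof clarify
      fix v assume v: "v \<in> verts G"
      then have "\<phi> v \<in> {1..l}" using \<phi>(2) by blast
      then show "\<psi> v \<in> {1..l - 1}"
        using less_or_greater[OF v] s by (auto simp: \<psi>_def)
    qed
    ultimately have "l \<le> l - 1"
      unfolding l_def chromatic_number_def by (intro Least_le) blast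
    with s show False by simp
  qed
  with \<phi> have "\<phi> \<in> chi_colourings G"
    unfolding chi_colourings_def l_def by blast
  then show ?thesis by blast
qed

lemma (in graph) ex_chi_minus_colouring: "\<exists>\<phi>. chi_minus_colouring G \<phi>"
  using greedy_max_nonempty[OF finite_verts chi_colourings_nonempty]
  unfolding chi_minus_colouring_def by blast

lemma (in graph) ex_chi_plus_colouring: "\<exists>\<phi>. chi_plus_colouring G \<phi>"
  using greedy_max_nonempty[OF finite_verts chi_colourings_nonempty]
  unfolding chi_plus_colouring_def by blast

end

theory Submission
  imports Defs
begin

text \<open>
  A proper colouring of \<open>K\<^bsub>a,b\<^esub>\<close> with two colours is constant on either part, so there are only
  two of them, and greedily maximising one colour puts it on a larger part. Distinct vertices
  have distance 1 if they lie in different parts and 2 otherwise; splitting the unordered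
  pairs into singletons, cross pairs and pairs within a part yields the coefficients.
\<close>

section \<open>Distances 0, 1 and 2 in terms of walks\<close>

context wf_digraph
begin

lemma gdist_self: "u \<in> verts G \<Longrightarrow> gdist G u u = 0"
  unfolding gdist_def by (intro Least_eq_0 exI[of _ "[]"]) (simp add: awalk_Nil_iff)

lemma awalk_length_0_iff: "(\<exists>p. awalk u p v \<and> length p = 0) \<longleftrightarrow> u = v \<and> u \<in> verts G"
  by (auto simp: awalk_Nil_iff)

lemma awalk_length_1_iff: "(\<exists>p. awalk u p v \<and> length p = 1) \<longleftrightarrow> (u, v) \<in> arcs_ends G"
proof
  assume "\<exists>p. awalk u p v \<and> length p = 1"
  then obtain e where "awalk u [e] v" by (auto simp: length_Suc_conv)
  then show "(u, v) \<in> arcs_ends G"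
    by (auto simp: awalk_Cons_iff awalk_Nil_iff arcs_ends_conv)
next
  assume "(u, v) \<in> arcs_ends G"
  then obtain e where "e \<in> arcs G" "tail G e = u" "head G e = v"
    by (auto simp: arcs_ends_conv)
  then have "awalk u [e] v" by (auto simp: awalk_Cons_iff awalk_Nil_iff)
  then show "\<exists>p. awalk u p v \<and> length p = 1"
    by (intro exI[of _ "[e]"]) simp
qed

lemma gdist_adjacent:
  assumes "(u, v) \<in> arcs_ends G" "u \<noteq> v"
  shows "gdist G u v = 1"
  unfolding gdist_def
proof (rule Least_equality)
  show "\<exists>p. awalk u p v \<and> length p = 1"
    using assms(1) awalk_length_1_iff by blast
  show "1 \<le> k" if "\<exists>p. awalk u p v \<and> length p = k" for k
    using that assms(2) awalk_length_0_iff[of u v] by (cases k) auto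
qed

text \<open>The walk through \<open>w\<close> gives the upper bound; length 0 would force
  \<open>u = v\<close> and length 1 an arc from \<open>u\<close> to \<open>v\<close>.\<close>

lemma gdist_common_neighbour:
  assumes "(u, w) \<in> arcs_ends G" "(w, v) \<in> arcs_ends G" "(u, v) \<notin> arcs_ends G" "u \<noteq> v"
  shows "gdist G u v = 2"
  unfolding gdist_def
proof (rule Least_equality)
  obtain p q where "awalk u p w" "length p = 1" "awalk w q v" "length q = 1"
    using assms(1,2) awalk_length_1_iff by metis
  then have "awalk u (p @ q) v" "length (p @ q) = 2" by auto
  then show "\<exists>p. awalk u p v \<and> length p = 2" by blast
  show "2 \<le> k" if "\<exists>p. awalk u p v \<and> length p = k" for k
  proof -
    have "k \<noteq> 0" using that assms(4) awalk_length_0_iff[of u v] by metis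
    moreover have "k \<noteq> 1" using that assms(3) awalk_length_1_iff[of u v] by metis
    ultimately show ?thesis by simp
  qed
qed

end

text \<open>One suitable ordering of each pair suffices, since \<open>schultz_term_pair\<close>
  evaluates the term at any ordering.\<close>

lemma (in sym_digraph) sum_schultz_term_const:
  assumes "\<And>P. P \<in> A \<Longrightarrow> \<exists>u v. P = {u, v} \<and> \<phi> u + \<phi> v = c \<and> gdist G u v = d"
  shows "sum (schultz_term G \<phi>) A = monom (int (card A * c)) d"
proof -
  have "schultz_term G \<phi> P = monom (int c) d" if "P \<in> A" for P
    using assms[OF that] by (auto simp: schultz_term_pair simp flip: of_nat_add)
  then have "sum (schultz_term G \<phi>) A = (\<Sum>P\<in>A. monom (int c) d)"
    by (intro sum.cong) auto
  also have "\<dots> = monom (int (card A * c)) d"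
    by (simp add: of_nat_poly smult_monom)
  finally show ?thesis .
qed

section \<open>Complete bipartite graphs: distances and chromatic number\<close>

locale complete_bipartite = graph G for G :: "('a, 'b) pre_digraph" +
  fixes U V :: "'a set"
  assumes verts_eq: "verts G = U \<union> V"
    and disjoint: "U \<inter> V = {}"
    and arcs_ends_eq: "arcs_ends G = U \<times> V \<union> V \<times> U"
    and U_nonempty: "U \<noteq> {}"
    and V_nonempty: "V \<noteq> {}"
begin

lemma finite_parts: "finite U" "finite V"
  using finite_verts verts_eq by auto

lemma gdist_cross: "u \<in> U \<Longrightarrow> v \<in> V \<Longrightarrow> gdist G u v = 1"
  using disjoint by (intro gdist_adjacent) (auto simp: arcs_ends_eq)

text \<open>Any vertex of the opposite, nonempty part is a common neighbour, and disjointness of the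
  parts rules out an arc inside a part.\<close>

lemma gdist_within:
  assumes "u \<noteq> v" "u \<in> U \<and> v \<in> U \<or> u \<in> V \<and> v \<in> V"
  shows "gdist G u v = 2"
proof -
  obtain w where "(u, w) \<in> arcs_ends G" "(w, v) \<in> arcs_ends G"
    using assms(2) U_nonempty V_nonempty by (auto simp: arcs_ends_eq)
  then show ?thesis
    using assms disjoint by (intro gdist_common_neighbour) (auto simp: arcs_ends_eq)
qed

lemma chromatic_number_eq: "chromatic_number G = 2"
  unfolding chromatic_number_def
proof (rule Least_equality)
  show "\<exists>\<phi>. proper_colouring G \<phi> \<and> \<phi> ` verts G \<subseteq> {1..2}"
    using disjoint
    by (intro exI[of _ "\<lambda>v. if v \<in> U then 1 else 2"])
      (auto simp: proper_colouring_def arcs_ends_eq split: if_splits)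
  fix k assume "\<exists>\<phi>. proper_colouring G \<phi> \<and> \<phi> ` verts G \<subseteq> {1..k}"
  then obtain \<phi> where \<phi>: "proper_colouring G \<phi>" "\<phi> ` verts G \<subseteq> {1..k}" by blast
  obtain u v where uv: "u \<in> U" "v \<in> V" using U_nonempty V_nonempty by blast
  then have "\<phi> u \<noteq> \<phi> v" using \<phi>(1) by (auto simp: proper_colouring_def arcs_ends_eq)
  moreover have "\<phi> u \<in> {1..k}" "\<phi> v \<in> {1..k}" using \<phi>(2) uv verts_eq by auto
  ultimately show "2 \<le> k" by auto
qed

section \<open>Optimal colourings\<close>

text \<open>A predicate rather than a function, because colourings are unconstrained outside the
  vertices. The parameters let one computation serve both assignments of the colours 1 and
  2.\<close>

definition part_colouring :: "nat \<Rightarrow> nat \<Rightarrow> ('a \<Rightarrow> nat) \<Rightarrow> bool" where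
  "part_colouring i j \<phi> \<longleftrightarrow> (\<forall>u \<in> U. \<phi> u = i) \<and> (\<forall>v \<in> V. \<phi> v = j)"

text \<open>Fix \<open>u\<close> in \<open>U\<close> and \<open>v\<close> in \<open>V\<close>. Every
  vertex of \<open>U\<close> avoids the colour of \<open>v\<close>, which with two colours leaves
  only the colour of \<open>u\<close>; symmetrically for \<open>V\<close>.\<close>

lemma chi_colourings_iff:
  "\<phi> \<in> chi_colourings G \<longleftrightarrow> part_colouring 1 2 \<phi> \<or> part_colouring 2 1 \<phi>"
proof
  assume "\<phi> \<in> chi_colourings G"
  then have \<phi>: "proper_colouring G \<phi>" "\<phi> ` verts G = {1..2}"
    by (auto simp: chi_colourings_def chromatic_number_eq)
  have ne: "\<phi> u \<noteq> \<phi> v" if "u \<in> U" "v \<in> V" for u v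
    using \<phi>(1) that by (auto simp: proper_colouring_def arcs_ends_eq)
  have range: "\<phi> w = 1 \<or> \<phi> w = 2" if "w \<in> U \<union> V" for w
  proof -
    have "\<phi> w \<in> {1..2}" using \<phi>(2) that verts_eq by blast
    then show ?thesis by auto
  qed
  obtain u v where uv: "u \<in> U" "v \<in> V" using U_nonempty V_nonempty by blast
  show "part_colouring 1 2 \<phi> \<or> part_colouring 2 1 \<phi>"
    unfolding part_colouring_def using ne uv range by (metis UnCI)
next
  have two: "{1..2} = {1, 2::nat}" by auto
  assume "part_colouring 1 2 \<phi> \<or> part_colouring 2 1 \<phi>"
  then show "\<phi> \<in> chi_colourings G"
    using U_nonempty V_nonempty
    unfolding chi_colourings_def chromatic_number_eq two
    by (auto simp: part_colouring_def proper_colouring_def arcs_ends_eq verts_eq image_Un)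
qed

lemma colour_weight_part_colouring:
  assumes "part_colouring i j \<phi>" "i \<noteq> j"
  shows "colour_weight G \<phi> i = card U" "colour_weight G \<phi> j = card V"
proof -
  have "{v \<in> verts G. \<phi> v = i} = U" "{v \<in> verts G. \<phi> v = j} = V"
    using assms by (auto simp: part_colouring_def verts_eq)
  then show "colour_weight G \<phi> i = card U" "colour_weight G \<phi> j = card V"
    by (simp_all add: colour_weight_def)
qed

lemma ex_part_colouring: "\<exists>\<phi>. part_colouring i j \<phi>"
  using disjoint
  by (intro exI[of _ "\<lambda>v. if v \<in> U then i else j"]) (auto simp: part_colouring_def)

text \<open>If \<open>U\<close> gets colour 2, then colour 1 occurs only \<open>card V\<close>
  times, which is maximal only in a tie. The tie stays as a second case because both colourings are
  then optimal.\<close>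

lemma chi_minus_cases:
  assumes "chi_minus_colouring G \<phi>" "card V \<le> card U"
  shows "part_colouring 1 2 \<phi> \<or> part_colouring 2 1 \<phi> \<and> card U = card V"
proof -
  have list: "[1..<Suc 2] = [1, 2]" by (simp add: upt_rec)
  have \<phi>: "\<phi> \<in> chi_colourings G"
    "\<forall>\<psi> \<in> chi_colourings G. colour_weight G \<psi> 1 \<le> colour_weight G \<phi> 1"
    using assms(1) unfolding chi_minus_colouring_def chromatic_number_eq list by auto
  \<comment> \<open>A competitor that puts colour 1 on the larger part \<open>U\<close> bounds the
    maximum from below.\<close>
  obtain \<psi> where \<psi>: "part_colouring 1 2 \<psi>" using ex_part_colouring by blast
  then have "card U \<le> colour_weight G \<phi> 1"
    using \<phi>(2) chi_colourings_iff colour_weight_part_colouring(1)[OF \<psi>] by force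
  then show ?thesis
    using \<phi>(1) assms(2) chi_colourings_iff colour_weight_part_colouring(2)[of 2 1 \<phi>] by force
qed

text \<open>Mirror image of \<open>chi_minus_cases\<close>: the greedy order now starts with colour
  2, so the competitor puts 2 on \<open>U\<close>.\<close>

lemma chi_plus_cases:
  assumes "chi_plus_colouring G \<phi>" "card V \<le> card U"
  shows "part_colouring 2 1 \<phi> \<or> part_colouring 1 2 \<phi> \<and> card U = card V"
proof -
  have list: "rev [1..<Suc 2] = [2, 1]" by (simp add: upt_rec)
  have \<phi>: "\<phi> \<in> chi_colourings G"
    "\<forall>\<psi> \<in> chi_colourings G. colour_weight G \<psi> 2 \<le> colour_weight G \<phi> 2"
    using assms(1) unfolding chi_plus_colouring_def chromatic_number_eq list by auto
  obtain \<psi> where \<psi>: "part_colouring 2 1 \<psi>" using ex_part_colouring by blast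
  then have "card U \<le> colour_weight G \<phi> 2"
    using \<phi>(2) chi_colourings_iff colour_weight_part_colouring(1)[OF \<psi>] by force
  then show ?thesis
    using \<phi>(1) assms(2) chi_colourings_iff colour_weight_part_colouring(2)[of 1 2 \<phi>] by force
qed

section \<open>Splitting the unordered pairs into five blocks\<close>

text \<open>On each block a part colouring has constant colour sum and the distance is constant. The
  unions nest to the right so that \<open>sum.union_disjoint\<close> peels off one block at a
  time.\<close>

lemma unordered_pairs_eq:
  "{{u, v} | u v. u \<in> verts G \<and> v \<in> verts G} =
     (\<lambda>u. {u}) ` U \<union> ((\<lambda>u. {u}) ` V \<union> ((\<lambda>(u, v). {u, v}) ` (U \<times> V) \<union>
       ({P. P \<subseteq> U \<and> card P = 2} \<union> {P. P \<subseteq> V \<and> card P = 2})))"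
  (is "?L = ?R")
proof
  show "?L \<subseteq> ?R"
  proof
    fix P assume "P \<in> ?L"
    then obtain u v where P: "P = {u, v}" and uv: "u \<in> U \<or> u \<in> V" "v \<in> U \<or> v \<in> V"
      by (auto simp: verts_eq)
    show "P \<in> ?R"
    proof (cases "u = v")
      case True
      then show ?thesis using P uv by auto
    next
      case False
      then have "card P = 2" using P by simp
      moreover have "P \<in> (\<lambda>(u, v). {u, v}) ` (U \<times> V)" if "u \<in> U \<and> v \<in> V \<or> u \<in> V \<and> v \<in> U"
        using that P by (auto simp: image_iff insert_commute)
      ultimately show ?thesis using P uv by blast
    qed
  qed
  have "P \<in> ?L" if "P \<subseteq> verts G" "card P = 2" for P
    using that unfolding card_2_iff by blast
  then have "{P. P \<subseteq> U \<and> card P = 2} \<subseteq> ?L" "{P. P \<subseteq> V \<and> card P = 2} \<subseteq> ?L"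
    unfolding verts_eq by blast+
  moreover have "(\<lambda>u. {u}) ` U \<subseteq> ?L" "(\<lambda>u. {u}) ` V \<subseteq> ?L"
    "(\<lambda>(u, v). {u, v}) ` (U \<times> V) \<subseteq> ?L"
    unfolding verts_eq by auto
  ultimately show "?R \<subseteq> ?L" by (intro Un_least)
qed

section \<open>Contribution of each block\<close>

lemma sum_schultz_term_singletons:
  assumes "A \<subseteq> verts G" "\<forall>u \<in> A. \<phi> u = c"
  shows "sum (schultz_term G \<phi>) ((\<lambda>u. {u}) ` A) = monom (2 * int c * int (card A)) 0"
proof -
  have "\<exists>u v. P = {u, v} \<and> \<phi> u + \<phi> v = c + c \<and> gdist G u v = 0" if P: "P \<in> (\<lambda>u. {u}) ` A" for P
  proof -
    obtain u where "u \<in> A" "P = {u}" using P by blast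
    then show ?thesis using assms gdist_self by (intro exI[of _ u]) auto
  qed
  then show ?thesis
    by (subst sum_schultz_term_const) (auto simp: card_image algebra_simps)
qed

lemma sum_schultz_term_cross:
  assumes "part_colouring i j \<phi>"
  shows "sum (schultz_term G \<phi>) ((\<lambda>(u, v). {u, v}) ` (U \<times> V)) =
    monom ((int i + int j) * int (card U) * int (card V)) 1"
proof -
  \<comment> \<open>As the parts are disjoint, the ordered pair can be recovered from the set, so no
    cross pair is counted twice.\<close>
  have "inj_on (\<lambda>(u, v). {u, v}) (U \<times> V)"
    using disjoint by (auto simp: inj_on_def doubleton_eq_iff)
  then have card: "card ((\<lambda>(u, v). {u, v}) ` (U \<times> V)) = card U * card V"
    by (simp add: card_image card_cartesian_product)
  have "\<exists>u v. P = {u, v} \<and> \<phi> u + \<phi> v = i + j \<and> gdist G u v = 1"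
    if P: "P \<in> (\<lambda>(u, v). {u, v}) ` (U \<times> V)" for P
  proof -
    obtain u v where "u \<in> U" "v \<in> V" "P = {u, v}" using P by blast
    then show ?thesis
      using assms gdist_cross by (intro exI[of _ u] exI[of _ v]) (auto simp: part_colouring_def)
  qed
  then have "sum (schultz_term G \<phi>) ((\<lambda>(u, v). {u, v}) ` (U \<times> V)) =
      monom (int (card U * card V * (i + j))) 1"
    unfolding card[symmetric] by (rule sum_schultz_term_const)
  then show ?thesis by (simp add: algebra_simps)
qed

text \<open>There are \<open>card A choose 2\<close> such pairs, each with colour sum
  \<open>2 * c\<close>; the factor 2 cancels the denominator of the binomial coefficient.\<close>

lemma sum_schultz_term_within:
  assumes "A = U \<or> A = V" "\<forall>u \<in> A. \<phi> u = c"
  shows "sum (schultz_term G \<phi>) {P. P \<subseteq> A \<and> card P = 2} =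
    monom (int c * int (card A) * (int (card A) - 1)) 2"
proof -
  have "finite A" using assms(1) finite_parts by auto
  \<comment> \<open>Makes the natural-number division by 2 in \<open>choose_two\<close>
    exact.\<close>
  have "even (card A * (card A - 1))" by (cases "card A") auto
  then obtain k where k: "card A * (card A - 1) = 2 * k" by (rule evenE)
  have "card {P. P \<subseteq> A \<and> card P = 2} * (c + c) = c * (card A * (card A - 1))"
    unfolding n_subsets[OF \<open>finite A\<close>] choose_two k by simp
  \<comment> \<open>Natural subtraction truncates \<open>card A - 1\<close> when \<open>A\<close> is
    empty; the factor \<open>card A\<close> then makes both sides 0.\<close>
  then have card: "int (card {P. P \<subseteq> A \<and> card P = 2} * (c + c)) =
      int c * int (card A) * (int (card A) - 1)"
    by (cases "card A") (simp_all add: algebra_simps)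
  have "\<exists>u v. P = {u, v} \<and> \<phi> u + \<phi> v = c + c \<and> gdist G u v = 2"
    if P: "P \<in> {P. P \<subseteq> A \<and> card P = 2}" for P
  proof -
    obtain u v where "u \<in> A" "v \<in> A" "u \<noteq> v" "P = {u, v}" using P by (auto simp: card_2_iff)
    then show ?thesis
      using assms gdist_within by (intro exI[of _ u] exI[of _ v]) auto
  qed
  then show ?thesis
    unfolding card[symmetric] by (rule sum_schultz_term_const)
qed

lemma schultz_poly_part_colouring:
  assumes \<phi>: "part_colouring i j \<phi>"
  shows "schultz_poly G \<phi> =
    [: 2 * int i * int (card U) + 2 * int j * int (card V),
       (int i + int j) * int (card U) * int (card V),
       int i * int (card U) * (int (card U) - 1) + int j * int (card V) * (int (card V) - 1) :]"
proof -
  let ?S = "\<lambda>A. (\<lambda>u. {u}) ` A" and ?T = "\<lambda>A. {P. P \<subseteq> A \<and> card P = 2}"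
    and ?X = "(\<lambda>(u, v). {u, v}) ` (U \<times> V)" and ?s = "sum (schultz_term G \<phi>)"
  have fin: "finite (?S U)" "finite (?S V)" "finite ?X" "finite (?T U)" "finite (?T V)"
    using finite_parts by auto
  \<comment> \<open>Cardinality separates singletons from the other blocks; disjointness of the
    parts separates the rest. The nesting is that of \<open>unordered_pairs_eq\<close>.\<close>
  have disj: "?T U \<inter> ?T V = {}" "?X \<inter> (?T U \<union> ?T V) = {}"
    "?S V \<inter> (?X \<union> (?T U \<union> ?T V)) = {}" "?S U \<inter> (?S V \<union> (?X \<union> (?T U \<union> ?T V))) = {}"
    using disjoint by (auto simp: card_2_iff)
  have colours: "\<forall>u \<in> U. \<phi> u = i" "\<forall>v \<in> V. \<phi> v = j"
    using \<phi> by (auto simp: part_colouring_def)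
  have sums:
    "?s (?S U) = monom (2 * int i * int (card U)) 0"
    "?s (?S V) = monom (2 * int j * int (card V)) 0"
    "?s ?X = monom ((int i + int j) * int (card U) * int (card V)) 1"
    "?s (?T U) = monom (int i * int (card U) * (int (card U) - 1)) 2"
    "?s (?T V) = monom (int j * int (card V) * (int (card V) - 1)) 2"
    using colours verts_eq
    by (intro sum_schultz_term_singletons sum_schultz_term_cross[OF \<phi>] sum_schultz_term_within;
        simp)+
  have poly: "monom x 0 + (monom y 0 + (monom z 1 + (monom r 2 + monom t 2))) = [: x + y, z, r + t :]"
    for x y z r t :: int
    by (simp add: monom_Suc monom_0 numeral_2_eq_2)
  have "schultz_poly G \<phi> = ?s (?S U) + (?s (?S V) + (?s ?X + (?s (?T U) + ?s (?T V))))"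
    unfolding schultz_poly_def unordered_pairs_eq
    using fin disj by (simp add: sum.union_disjoint)
  also have "\<dots> =
    [: 2 * int i * int (card U) + 2 * int j * int (card V),
       (int i + int j) * int (card U) * int (card V),
       int i * int (card U) * (int (card U) - 1) + int j * int (card V) * (int (card V) - 1) :]"
    unfolding sums poly by simp
  finally show ?thesis .
qed

end

section \<open>The two Schultz polynomials\<close>

theorem theorem2p8:
  fixes G :: "('a, 'b) pre_digraph" and a b n :: nat
    and \<phi>minus \<phi>plus :: "'a \<Rightarrow> nat"
  assumes "complete_bipartite_digraph a b G"
    and "b \<ge> 1" and "a \<ge> b" and "a + b = n"
    and "chi_minus_colouring G \<phi>minus"
    and "chi_plus_colouring G \<phi>plus"
  shows "schultz_poly G \<phi>minus =
           [: 2 * int a + 4 * int b,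
              3 * int a * int b,
              int a * (int a - 1) + 2 * int b * (int b - 1) :]
       \<and> schultz_poly G \<phi>plus =
           [: 4 * int a + 2 * int b,
              3 * int a * int b,
              2 * int a * (int a - 1) + int b * (int b - 1) :]"
proof -
  obtain U V where UV: "verts G = U \<union> V" "U \<inter> V = {}" "arcs_ends G = U \<times> V \<union> V \<times> U"
    and card: "card U = a" "card V = b" and "graph G"
    using assms(1) by (auto simp: complete_bipartite_digraph_def)
  interpret graph G by fact
  \<comment> \<open>Both cardinalities are at least 1, so neither part is empty.\<close>
  interpret complete_bipartite G U V
    using UV card assms(2,3) by unfold_locales auto
  have le: "card V \<le> card U" using assms(3) card by simp
  \<comment> \<open>In the tie case the colours are swapped, but then \<open>a = b\<close> and the
    formula is unchanged.\<close>
  show ?thesis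
    using chi_minus_cases[OF assms(5) le] chi_plus_cases[OF assms(6) le] card
    by (auto simp: schultz_poly_part_colouring algebra_simps)
qed

end
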